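(* Let $b$ be a nonzero integer and let $k\geq 1$ be an integer with $k\in\chi(0,b)$. Let $p$ be an odd prime that is a $k$-PL prime relative to $(0,b)$, and suppose that $(F_1/p)=(F_2/p)=1$, where $F_i$ is the $i$th term of the $(0,b)$-Fibonacci sequence. Let $G$ be a connected graph of order $n$ and size $n(2k-1)+\varepsilon$, where $\varepsilon\in\{-1,0,1\}$. Then the corona graph $G\circ P_{\pi_p(0,b)-1}$ is a $(0,b)$-FLC graph modulo $p$.
   Context: All graphs are finite and simple with nonempty vertex set; order means number of vertices and size means number of edges. For integers $a,b$, the $(a,b)$-Fibonacci sequence is $F_0=a$, $F_1=b$, $F_n=F_{n-1}+F_{n-2}$ for $n\ge 2$. $(x/p)$ denotes the Legendre symbol for an odd prime $p$ (equal to $0$ when $p\mid x$). The $(a,b)$-Pisano period $\pi_p(a,b)$ is the smallest positive integer $t$ such that $F_{n+t}\equiv F_n \pmod p$ for all $n\ge 0$. For an odd prime $p$ and $j\in\{-1,0,1\}$, let $\Lambda_j^p(a,b)=\{\xi\in\{0,1,\ldots,\pi_p(a,b)-1\} : (F_\xi/p)=j\}$. The prime $p$ is a $k$-PL prime ($k$-Pisano-Legendre prime) relative to $(a,b)$ if $k=|\Lambda_1^p(a,b)|-|\Lambda_{-1}^p(a,b)|-|\Lambda_0^p(a,b)|$. The Pisano set $\chi(a,b)$ is the set of all integers $k$ for which there exists an odd prime $p$ that is a $k$-PL prime relative to $(a,b)$. Let $\Gamma$ be a simple connected graph of order $N$. A bijection $f:V(\Gamma)\to\{0,1,\ldots,N-1\}$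 is an $(a,b)$-FLC labeling (Fibonacci-Legendre cordial labeling) modulo $p$ if the induced edge labeling $f_p^*:E(\Gamma)\to\{0,1\}$, given by $f_p^*(uv)=\frac{1+([F_{f(u)}+F_{f(v)}]/p)}{2}$ if $F_{f(u)}+F_{f(v)}\not\equiv 0\pmod p$ and $f_p^*(uv)=0$ otherwise, satisfies $|e_{f_p^*}(0)-e_{f_p^*}(1)|\le 1$, where $e_{f_p^*}(i)$ is the number of edges labeled $i$. A graph admitting such a labeling is an $(a,b)$-FLC graph modulo $p$. $P_n$ is the path graph on $n$ vertices. If $G_1$ has order $n$, the corona graph $G_1\circ G_2$ is obtained by taking one copy of $G_1$ and $n$ disjoint copies of $G_2$, and joining the $i$th vertex of $G_1$ to every vertex of the $i$th copy of $G_2$. *)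

theory Defs
  imports "HOL-Number_Theory.Number_Theory" "Graph_Theory.Graph_Theory"
begin

section \<open>Fibonacci sequences, Pisano periods and Pisano-Legendre primes\<close>

text \<open>
  The library's \<open>gen_fib\<close> only takes natural-number seeds.
\<close>

fun fib_seq :: "int \<Rightarrow> int \<Rightarrow> nat \<Rightarrow> int" where
  "fib_seq a b 0 = a"
| "fib_seq a b (Suc 0) = b"
| "fib_seq a b (Suc (Suc n)) = fib_seq a b (Suc n) + fib_seq a b n"

definition pisano_period :: "nat \<Rightarrow> int \<Rightarrow> int \<Rightarrow> nat" where
  "pisano_period p a b =
     (LEAST t. 0 < t \<and> (\<forall>n. [fib_seq a b (n + t) = fib_seq a b n] (mod int p)))"

definition legendre_class :: "int \<Rightarrow> nat \<Rightarrow> int \<Rightarrow> int \<Rightarrow> nat set" where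
  "legendre_class j p a b =
     {\<xi> \<in> {0..<pisano_period p a b}. Legendre (fib_seq a b \<xi>) (int p) = j}"

definition PL_prime :: "int \<Rightarrow> int \<Rightarrow> int \<Rightarrow> nat \<Rightarrow> bool" where
  "PL_prime a b k p \<longleftrightarrow>
     prime p \<and> odd p \<and>
     k = int (card (legendre_class 1 p a b)) - int (card (legendre_class (-1) p a b))
           - int (card (legendre_class 0 p a b))"

definition pisano_set :: "int \<Rightarrow> int \<Rightarrow> int set" where
  "pisano_set a b = {k. \<exists>p. PL_prime a b k p}"


section \<open>Graphs\<close>

text \<open>
  Finite simple graphs are the symmetric loop-free digraphs without parallel arcs of
  \<^locale>\<open>pair_graph\<close>. An undirected edge is thus a pair of opposite arcs, so
  edges have to be counted as two-element sets of end points rather than as arcs.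
  \<^const>\<open>connected\<close> includes that the vertex set is nonempty.
\<close>

definition simple_connected_graph :: "'a pair_pre_digraph \<Rightarrow> bool" where
  "simple_connected_graph G \<longleftrightarrow> pair_graph G \<and> connected (with_proj G)"

definition graph_order :: "'a pair_pre_digraph \<Rightarrow> nat" where
  "graph_order G = card (pverts G)"

definition graph_edges :: "'a pair_pre_digraph \<Rightarrow> 'a set set" where
  "graph_edges G = {{u, v} | u v. (u, v) \<in> parcs G}"

definition graph_size :: "'a pair_pre_digraph \<Rightarrow> nat" where
  "graph_size G = card (graph_edges G)"

definition path_graph :: "nat \<Rightarrow> nat pair_pre_digraph" where
  "path_graph n =
     \<lparr>pverts = {0..<n},
      parcs = {(i, j). i < n \<and> j < n \<and> (j = Suc i \<or> i = Suc j)}\<rparr>"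

text \<open>
  In the corona, \<open>Inl v\<close> is the vertex \<open>v\<close> of the copy of \<open>G\<close>, and \<open>Inr (v, w)\<close> is the
  vertex \<open>w\<close> of the copy of \<open>H\<close> attached to \<open>v\<close>.
\<close>

definition corona ::
  "'a pair_pre_digraph \<Rightarrow> 'b pair_pre_digraph \<Rightarrow> ('a + 'a \<times> 'b) pair_pre_digraph" where
  "corona G H =
     \<lparr>pverts = Inl ` pverts G \<union> Inr ` (pverts G \<times> pverts H),
      parcs = {(Inl u, Inl v) | u v. (u, v) \<in> parcs G}
            \<union> {(Inr (v, w), Inr (v, w')) | v w w'. v \<in> pverts G \<and> (w, w') \<in> parcs H}
            \<union> {(Inl v, Inr (v, w)) | v w. v \<in> pverts G \<and> w \<in> pverts H}
            \<union> {(Inr (v, w), Inl v) | v w. v \<in> pverts G \<and> w \<in> pverts H}\<rparr>"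


section \<open>Fibonacci-Legendre cordial labelings\<close>

text \<open>
  The division by 2 is exact: in the second branch the Legendre symbol is 1 or -1.
\<close>

definition induced_label :: "int \<Rightarrow> int \<Rightarrow> nat \<Rightarrow> ('a \<Rightarrow> nat) \<Rightarrow> 'a \<Rightarrow> 'a \<Rightarrow> int" where
  "induced_label a b p f u v =
     (let s = fib_seq a b (f u) + fib_seq a b (f v)
      in if [s = 0] (mod int p) then 0 else (1 + Legendre s (int p)) div 2)"

definition edges_labeled ::
  "int \<Rightarrow> int \<Rightarrow> nat \<Rightarrow> 'a pair_pre_digraph \<Rightarrow> ('a \<Rightarrow> nat) \<Rightarrow> int \<Rightarrow> 'a set set" where
  "edges_labeled a b p G f i =
     {{u, v} | u v. (u, v) \<in> parcs G \<and> induced_label a b p f u v = i}"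

definition FLC_labeling ::
  "int \<Rightarrow> int \<Rightarrow> nat \<Rightarrow> 'a pair_pre_digraph \<Rightarrow> ('a \<Rightarrow> nat) \<Rightarrow> bool" where
  "FLC_labeling a b p G f \<longleftrightarrow>
     bij_betw f (pverts G) {0..<graph_order G} \<and>
     \<bar>int (card (edges_labeled a b p G f 0)) - int (card (edges_labeled a b p G f 1))\<bar> \<le> 1"

definition FLC_graph :: "int \<Rightarrow> int \<Rightarrow> nat \<Rightarrow> 'a pair_pre_digraph \<Rightarrow> bool" where
  "FLC_graph a b p G \<longleftrightarrow> simple_connected_graph G \<and> (\<exists>f. FLC_labeling a b p G f)"

end

theory Submission
  imports Defs
begin

text \<open>
  Let \<open>t\<close> be the Pisano period. Label the vertices of \<open>G\<close> by the multiples of \<open>t\<close>, and the path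
  attached to the vertex labeled \<open>t * i\<close> by \<open>t * i + 1, \<dots>, t * i + (t - 1)\<close> in order. Since
  \<open>F 0 = 0\<close>, all edges of \<open>G\<close> get label 0, and the edge joining \<open>t * i\<close> to \<open>t * i + r\<close> is
  labeled according to the Legendre symbol of \<open>F r\<close>; on the path, \<open>F r + F (r + 1) = F (r + 2)\<close>.
  Over one period, labels 1 exceed labels 0 by \<open>k\<close>. The \<open>t - 1\<close> spokes miss only the index 0, which
  is labeled 0, giving an excess of \<open>k + 1\<close>. The path edges have the indices \<open>3, \<dots>, t\<close>,
  so they miss 1 and 2, both labeled 1, giving an excess of \<open>k - 2\<close>. The total excess
  \<open>n * (2 * k - 1)\<close> is cancelled by the edges of \<open>G\<close> up to \<open>\<epsilon>\<close>.
\<close>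

section \<open>Pisano periods\<close>

lemma fib_seq_cong_propagate:
  assumes "[fib_seq a b i = fib_seq a b j] (mod m)"
    and "[fib_seq a b (Suc i) = fib_seq a b (Suc j)] (mod m)"
  shows "[fib_seq a b (i + n) = fib_seq a b (j + n)] (mod m)"
proof -
  have "[fib_seq a b (i + n) = fib_seq a b (j + n)] (mod m)
      \<and> [fib_seq a b (Suc (i + n)) = fib_seq a b (Suc (j + n))] (mod m)"
    using assms by (induction n) (auto intro: cong_add)
  then show ?thesis ..
qed

text \<open>The recurrence also runs backwards, because a term is the difference of the next two. A
  repeated pair of neighbours therefore moves down to index 0, which makes the sequence purely
  periodic and not just eventually periodic.\<close>

lemma fib_seq_cong_shift_back:
  assumes "[fib_seq a b (i + d) = fib_seq a b i] (mod m)"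
    and "[fib_seq a b (Suc (i + d)) = fib_seq a b (Suc i)] (mod m)"
  shows "[fib_seq a b d = fib_seq a b 0] (mod m) \<and> [fib_seq a b (Suc d) = fib_seq a b (Suc 0)] (mod m)"
  using assms
proof (induction i)
  case (Suc i)
  have "[fib_seq a b (Suc (Suc (i + d))) - fib_seq a b (Suc (i + d)) =
      fib_seq a b (Suc (Suc i)) - fib_seq a b (Suc i)] (mod m)"
    using Suc.prems by (intro cong_diff) simp_all
  then have "[fib_seq a b (i + d) = fib_seq a b i] (mod m)"
    by simp
  with Suc show ?case
    by simp
qed simp

text \<open>Pigeonhole: there are only finitely many pairs of residues of neighbouring terms, so
  some pair repeats. This guarantees that the \<open>LEAST\<close> in \<open>pisano_period\<close>
  is attained.\<close>

lemma ex_fib_seq_period: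
  assumes "0 < p"
  shows "\<exists>t>0. \<forall>n. [fib_seq a b (n + t) = fib_seq a b n] (mod int p)"
proof -
  define g where "g n = (fib_seq a b n mod int p, fib_seq a b (Suc n) mod int p)" for n
  have "range g \<subseteq> {0..<int p} \<times> {0..<int p}"
    using assms by (auto simp: g_def)
  then have "finite (range g)"
    by (rule finite_subset) simp
  then have "\<not> inj g"
    using finite_imageD by blast
  then obtain i j where "i < j" "g i = g j"
    unfolding inj_def by (metis nat_neq_iff)
  then obtain d where d: "0 < d" "g (i + d) = g i"
    by (metis less_imp_add_positive)
  then have "[fib_seq a b d = fib_seq a b 0] (mod int p) \<and>
      [fib_seq a b (Suc d) = fib_seq a b (Suc 0)] (mod int p)"
    by (intro fib_seq_cong_shift_back[where i = i]) (simp_all add: g_def cong_def)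
  then have "[fib_seq a b (d + n) = fib_seq a b (0 + n)] (mod int p)" for n
    by (intro fib_seq_cong_propagate) auto
  with d(1) show ?thesis
    by (metis add.commute add_0)
qed

lemma
  assumes "0 < p"
  shows pisano_period_pos: "0 < pisano_period p a b"
    and fib_seq_pisano_period: "[fib_seq a b (n + pisano_period p a b) = fib_seq a b n] (mod int p)"
  using LeastI_ex[OF ex_fib_seq_period[OF assms, of a b]]
  by (simp_all add: pisano_period_def)

lemma fib_seq_add_mult_pisano_period:
  assumes "0 < p"
  shows "[fib_seq a b (pisano_period p a b * i + n) = fib_seq a b n] (mod int p)"
proof (induction i)
  case (Suc i)
  have "[fib_seq a b ((pisano_period p a b * i + n) + pisano_period p a b) =
      fib_seq a b (pisano_period p a b * i + n)] (mod int p)"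
    by (rule fib_seq_pisano_period[OF assms])
  then show ?case
    using Suc.IH cong_trans by (simp add: algebra_simps) blast
qed simp

section \<open>Legendre symbols and induced labels\<close>

lemma Legendre_cong:
  assumes "[a = b] (mod m)"
  shows "Legendre a m = Legendre b m"
  using assms by (simp add: Legendre_def QuadRes_def cong_def)

lemma Legendre_cases: "Legendre a m \<in> {-1, 0, 1}"
  by (simp add: Legendre_def)

text \<open>A zero sum and a nonresidue both get label 0, so the case distinction collapses to a
  test for symbol 1, which depends only on the sum mod \<open>p\<close>.\<close>

lemma induced_label_eq:
  assumes "[fib_seq a b (f u) + fib_seq a b (f v) = c] (mod int p)"
  shows "induced_label a b p f u v = of_bool (Legendre c (int p) = 1)"
proof -
  define s where "s = fib_seq a b (f u) + fib_seq a b (f v)"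
  have "Legendre c (int p) = Legendre s (int p)"
    using Legendre_cong[OF assms] by (simp add: s_def)
  then show ?thesis
    unfolding induced_label_def s_def[symmetric] Let_def
    by (simp add: Legendre_def)
qed

lemma induced_label_commute: "induced_label a b p f u v = induced_label a b p f v u"
  by (simp add: induced_label_def add.commute)

text \<open>This eliminates the classes of -1 and 0, so that \<open>k\<close> can be expressed by
  the class of 1 and the period alone.\<close>

lemma card_legendre_classes:
  "card (legendre_class 1 p a b) + card (legendre_class (-1) p a b) + card (legendre_class 0 p a b)
    = pisano_period p a b"
proof -
  have "{0..<pisano_period p a b} =
      (legendre_class 1 p a b \<union> legendre_class (-1) p a b) \<union> legendre_class 0 p a b"
    using Legendre_cases by (fastforce simp: legendre_class_def)
  then have "pisano_period p a b =
      card ((legendre_class 1 p a b \<union> legendre_class (-1) p a b) \<union> legendre_class 0 p a b)"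
    by (metis card_atLeastLessThan diff_zero)
  also have "\<dots> = card (legendre_class 1 p a b) + card (legendre_class (-1) p a b)
      + card (legendre_class 0 p a b)"
    by (subst card_Un_disjoint card_Un_disjoint; auto simp: legendre_class_def)+
  finally show ?thesis ..
qed


section \<open>Coronas\<close>

lemma pair_graph_path_graph: "pair_graph (path_graph m)"
proof
  have "parcs (path_graph m) \<subseteq> {0..<m} \<times> {0..<m}"
    by (auto simp: path_graph_def)
  then show "finite (parcs (path_graph m))"
    by (rule finite_subset) simp
qed (auto simp: path_graph_def symmetric_def sym_def)

lemma pair_graph_corona:
  assumes "pair_graph G" "pair_graph H"
  shows "pair_graph (corona G H)"
proof -
  interpret G: pair_graph G by fact
  interpret H: pair_graph H by fact
  have verts: "finite (pverts (corona G H))"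
    by (simp add: corona_def G.pair_finite_verts H.pair_finite_verts)
  have G_in: "u \<in> pverts G \<and> v \<in> pverts G" if "(u, v) \<in> parcs G" for u v
    using G.arc_fst_in_verts[OF that] G.arc_snd_in_verts[OF that] by simp
  have H_in: "u \<in> pverts H \<and> v \<in> pverts H" if "(u, v) \<in> parcs H" for u v
    using H.arc_fst_in_verts[OF that] H.arc_snd_in_verts[OF that] by simp
  have wf: "fst e \<in> pverts (corona G H) \<and> snd e \<in> pverts (corona G H)"
    if "e \<in> parcs (corona G H)" for e
    using that G_in H_in by (auto simp: corona_def)
  then have "parcs (corona G H) \<subseteq> pverts (corona G H) \<times> pverts (corona G H)"
    by (auto simp: mem_Times_iff)
  then have arcs: "finite (parcs (corona G H))"
    by (rule finite_subset) (simp add: verts)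
  have sym: "sym (parcs (corona G H))"
    using G.graph_symmetric H.graph_symmetric by (auto simp: corona_def sym_def)
  show ?thesis
  proof
    show "symmetric (with_proj (corona G H))"
      using sym by (simp add: symmetric_def)
  next
    fix e assume "e \<in> parcs (corona G H)"
    then show "fst e \<noteq> snd e"
      using G.pair_no_loops H.pair_no_loops by (fastforce simp: corona_def)
  qed (use wf verts arcs in auto)
qed

text \<open>Every vertex reaches the copy of \<open>G\<close>, along a spoke if necessary, and walks
  of \<open>G\<close> lift to that copy.\<close>

lemma connected_corona:
  assumes "simple_connected_graph G" "pair_graph H"
  shows "connected (with_proj (corona G H))"
proof -
  interpret G: pair_graph G
    using assms by (simp add: simple_connected_graph_def)
  interpret C: pair_graph "corona G H"
    using assms by (simp add: simple_connected_graph_def pair_graph_corona)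
  have sc: "strongly_connected (with_proj G)"
    using assms G.pair_sym_arcs
    by (intro G.symmetric_connected_imp_strongly_connected) (auto simp: simple_connected_graph_def)
  have lift: "Inl u \<rightarrow>\<^sup>*\<^bsub>with_proj (corona G H)\<^esub> Inl v" if "u \<rightarrow>\<^sup>*\<^bsub>with_proj G\<^esub> v" for u v
    using that
  proof (induction rule: G.reachable_induct)
    case base
    then show ?case by (intro C.reachable_refl) (simp add: corona_def)
  next
    case (step x y)
    then have "(Inl x, Inl y) \<in> parcs (corona G H)"
      by (auto simp: corona_def)
    with step.IH show ?case
      using C.reachable_adj_trans by simp
  qed
  have hub: "\<exists>u\<in>pverts G. x \<rightarrow>\<^sup>*\<^bsub>with_proj (corona G H)\<^esub> Inl u" if "x \<in> pverts (corona G H)" for x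
  proof (cases x)
    case (Inl u)
    with that have "u \<in> pverts G"
      by (auto simp: corona_def)
    then show ?thesis
      using that Inl C.reachable_refl by blast
  next
    case (Inr vw)
    with that obtain v w where "x = Inr (v, w)" "v \<in> pverts G" "w \<in> pverts H"
      by (auto simp: corona_def)
    then have "(x, Inl v) \<in> parcs (corona G H)"
      by (auto simp: corona_def)
    then show ?thesis
      using \<open>v \<in> pverts G\<close> C.reachable_adjI by auto
  qed
  have reach: "x \<rightarrow>\<^sup>*\<^bsub>with_proj (corona G H)\<^esub> y"
    if xy: "x \<in> pverts (corona G H)" "y \<in> pverts (corona G H)" for x y
  proof -
    obtain u v where uv: "u \<in> pverts G" "x \<rightarrow>\<^sup>*\<^bsub>with_proj (corona G H)\<^esub> Inl u"
      "v \<in> pverts G" "y \<rightarrow>\<^sup>*\<^bsub>with_proj (corona G H)\<^esub> Inl v"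
      using hub xy by blast
    have "Inl u \<rightarrow>\<^sup>*\<^bsub>with_proj (corona G H)\<^esub> Inl v"
      using sc uv by (intro lift) (auto simp: strongly_connected_def)
    with uv show ?thesis
      by (meson C.reachable_trans C.symmetric_reachable')
  qed
  have "pverts G \<noteq> {}"
    using sc by (simp add: strongly_connected_def)
  with reach show ?thesis
    unfolding connected_def
    by (intro strongly_connectedI C.reachable_mk_symmetricI) (auto simp: corona_def)
qed


section \<open>Edge labels in coronas with paths\<close>

text \<open>Since labels are symmetric, each spoke and each path edge can be given one fixed
  orientation: away from the centre, or upwards along the path. This indexes those edges by pairs
  \<open>(v, w)\<close>.\<close>

lemma edges_labeled_corona_path:
  "edges_labeled a b p (corona G (path_graph m)) f i =
     (`) Inl ` {{u, v} | u v. (u, v) \<in> parcs G \<and> induced_label a b p f (Inl u) (Inl v) = i}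
   \<union> (\<lambda>(v, w). {Inl v, Inr (v, w)}) `
        {(v, w). v \<in> pverts G \<and> w < m \<and> induced_label a b p f (Inl v) (Inr (v, w)) = i}
   \<union> (\<lambda>(v, w). {Inr (v, w), Inr (v, Suc w)}) `
        {(v, w). v \<in> pverts G \<and> Suc w < m \<and>
           induced_label a b p f (Inr (v, w)) (Inr (v, Suc w)) = i}"
  (is "?L = ?A \<union> ?B \<union> ?C")
proof (intro equalityI subsetI)
  fix e assume "e \<in> ?L"
  then obtain x y where e: "e = {x, y}" and xy: "(x, y) \<in> parcs (corona G (path_graph m))"
    and i: "induced_label a b p f x y = i"
    by (auto simp: edges_labeled_def)
  from xy consider
      (base) u v where "x = Inl u" "y = Inl v" "(u, v) \<in> parcs G"
    | (spoke) v w where "v \<in> pverts G" "w < m"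
        "x = Inl v \<and> y = Inr (v, w) \<or> y = Inl v \<and> x = Inr (v, w)"
    | (path) v w where "v \<in> pverts G" "Suc w < m"
        "x = Inr (v, w) \<and> y = Inr (v, Suc w) \<or> y = Inr (v, w) \<and> x = Inr (v, Suc w)"
    by (auto simp: corona_def path_graph_def)
  then show "e \<in> ?A \<union> ?B \<union> ?C"
  proof cases
    case base
    then have "e = Inl ` {u, v}" using e by auto
    then show ?thesis using base i by blast
  next
    case spoke
    then have "e = {Inl v, Inr (v, w)}" "induced_label a b p f (Inl v) (Inr (v, w)) = i"
      using e i by (auto simp: induced_label_commute)
    then show ?thesis using spoke by auto
  next
    case path
    then have "e = {Inr (v, w), Inr (v, Suc w)}"
      "induced_label a b p f (Inr (v, w)) (Inr (v, Suc w)) = i"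
      using e i by (auto simp: induced_label_commute)
    then show ?thesis using path by auto
  qed
next
  fix e assume "e \<in> ?A \<union> ?B \<union> ?C"
  then consider
      (base) u v where "e = {Inl u, Inl v}" "(u, v) \<in> parcs G"
        "induced_label a b p f (Inl u) (Inl v) = i"
    | (spoke) v w where "e = {Inl v, Inr (v, w)}" "v \<in> pverts G" "w < m"
        "induced_label a b p f (Inl v) (Inr (v, w)) = i"
    | (path) v w where "e = {Inr (v, w), Inr (v, Suc w)}" "v \<in> pverts G" "Suc w < m"
        "induced_label a b p f (Inr (v, w)) (Inr (v, Suc w)) = i"
    by auto
  then show "e \<in> ?L"
  proof cases
    case base
    moreover from base have "(Inl u, Inl v) \<in> parcs (corona G (path_graph m))"
      by (auto simp: corona_def)
    ultimately show ?thesis unfolding edges_labeled_def by blast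
  next
    case spoke
    moreover from spoke have "(Inl v, Inr (v, w)) \<in> parcs (corona G (path_graph m))"
      by (auto simp: corona_def path_graph_def)
    ultimately show ?thesis unfolding edges_labeled_def by blast
  next
    case path
    moreover from path have "(Inr (v, w), Inr (v, Suc w)) \<in> parcs (corona G (path_graph m))"
      by (auto simp: corona_def path_graph_def)
    ultimately show ?thesis unfolding edges_labeled_def by blast
  qed
qed

text \<open>If the labels of spokes and path edges depend only on the position \<open>w\<close>,
  every vertex of \<open>G\<close> contributes the same number of them.\<close>

lemma card_edges_labeled_corona_path:
  assumes "pair_graph G"
    and spoke: "\<And>v w. v \<in> pverts G \<Longrightarrow> w < m \<Longrightarrow>
      induced_label a b p f (Inl v) (Inr (v, w)) = i \<longleftrightarrow> P w"
    and path: "\<And>v w. v \<in> pverts G \<Longrightarrow> Suc w < m \<Longrightarrow>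
      induced_label a b p f (Inr (v, w)) (Inr (v, Suc w)) = i \<longleftrightarrow> Q w"
  shows "card (edges_labeled a b p (corona G (path_graph m)) f i) =
      card {{u, v} | u v. (u, v) \<in> parcs G \<and> induced_label a b p f (Inl u) (Inl v) = i}
      + card (pverts G) * (card {w. w < m \<and> P w} + card {w. Suc w < m \<and> Q w})"
proof -
  interpret G: pair_graph G by fact
  let ?E = "{{u, v} | u v. (u, v) \<in> parcs G \<and> induced_label a b p f (Inl u) (Inl v) = i}"
  let ?S = "pverts G \<times> {w. w < m \<and> P w}" and ?R = "pverts G \<times> {w. Suc w < m \<and> Q w}"
  let ?A = "(`) Inl ` ?E :: ('a + 'a \<times> nat) set set"
  let ?B = "(\<lambda>(v, w). {Inl v, Inr (v, w)}) ` ?S"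
  let ?C = "(\<lambda>(v, w). {Inr (v, w), Inr (v, Suc w)}) ` ?R :: ('a + 'a \<times> nat) set set"
  have "{(v, w). v \<in> pverts G \<and> w < m \<and> induced_label a b p f (Inl v) (Inr (v, w)) = i} = ?S"
    using spoke by auto
  moreover have "{(v, w). v \<in> pverts G \<and> Suc w < m \<and>
      induced_label a b p f (Inr (v, w)) (Inr (v, Suc w)) = i} = ?R"
    using path by auto
  ultimately have eq: "edges_labeled a b p (corona G (path_graph m)) f i = ?A \<union> ?B \<union> ?C"
    by (simp only: edges_labeled_corona_path)
  have "?E \<subseteq> (\<lambda>(u, v). {u, v}) ` parcs G"
    by auto
  then have "finite ?E"
    using G.pair_finite_arcs finite_surj by blast
  moreover have "finite {w. Suc w < m \<and> Q w}"
    by (rule finite_subset[of _ "{..<m}"]) auto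
  then have "finite ?S" "finite ?R"
    by (simp_all add: G.pair_finite_verts)
  ultimately have fin: "finite ?A" "finite ?B" "finite ?C"
    by simp_all
  \<comment> \<open>The three kinds of edges differ in their end points: only \<open>Inl\<close>,
    one of each, only \<open>Inr\<close>.\<close>
  have "?A \<inter> ?B = {}" "(?A \<union> ?B) \<inter> ?C = {}"
    by (auto simp: doubleton_eq_iff)
  then have "card (?A \<union> ?B \<union> ?C) = card ?A + card ?B + card ?C"
    using fin by (simp add: card_Un_disjoint)
  moreover have "card ?A = card ?E"
    by (intro card_image inj_on_image) simp
  moreover have "card ?B = card ?S"
    by (intro card_image) (auto simp: inj_on_def doubleton_eq_iff)
  moreover have "card ?C = card ?R"
    by (intro card_image) (auto simp: inj_on_def doubleton_eq_iff)
  ultimately show ?thesis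
    by (simp add: eq card_cartesian_product distrib_left)
qed

text \<open>Division with remainder by \<open>t\<close>; the inverse is given by \<open>div\<close>
  and \<open>mod\<close>.\<close>

lemma bij_betw_mult_add:
  fixes n t :: nat
  shows "bij_betw (\<lambda>(i, r). t * i + r) ({0..<n} \<times> {0..<t}) {0..<n * t}"
proof (rule bij_betwI[where g = "\<lambda>x. (x div t, x mod t)"])
  show "(\<lambda>(i, r). t * i + r) \<in> {0..<n} \<times> {0..<t} \<rightarrow> {0..<n * t}"
  proof clarsimp
    fix i r assume "i < n" "r < t"
    then have "t * i + r < t * Suc i" by simp
    also have "\<dots> \<le> t * n" using \<open>i < n\<close> by (intro mult_le_mono) auto
    finally show "t * i + r < n * t" by (simp add: mult.commute)
  qed
  show "(\<lambda>x. (x div t, x mod t)) \<in> {0..<n * t} \<rightarrow> {0..<n} \<times> {0..<t}"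
    by (cases "t = 0") (auto simp: less_mult_imp_div_less)
qed auto

theorem theorem3p5:
  fixes b k \<epsilon> :: int and p n :: nat and G :: "'a pair_pre_digraph"
  assumes "b \<noteq> 0"
    and "k \<ge> 1"
    and "k \<in> pisano_set 0 b"
    and "PL_prime 0 b k p"
    and "Legendre (fib_seq 0 b 1) (int p) = 1"
    and "Legendre (fib_seq 0 b 2) (int p) = 1"
    and "simple_connected_graph G"
    and "graph_order G = n"
    and "\<epsilon> \<in> {-1, 0, 1}"
    and "int (graph_size G) = int n * (2 * k - 1) + \<epsilon>"
  shows "FLC_graph 0 b p (corona G (path_graph (pisano_period p 0 b - 1)))"
proof -
  define t where "t = pisano_period p 0 b"
  define F where "F = fib_seq 0 b"
  define m where "m = t - 1"
  define C where "C = corona G (path_graph m)"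
  define A where "A = {i. i < t \<and> Legendre (F i) (int p) = 1}"
  interpret G: pair_graph G
    using assms(7) by (simp add: simple_connected_graph_def)
  have "0 < p"
    using assms(4) by (auto simp: PL_prime_def prime_gt_0_nat)
  have F0: "F 0 = 0" and F_Suc2: "F (Suc (Suc i)) = F (Suc i) + F i" for i
    by (simp_all add: F_def)
  have L0: "Legendre (F 0) (int p) = 0"
    by (simp add: F0 Legendre_def)
  have L1: "Legendre (F 1) (int p) = 1" and L2: "Legendre (F 2) (int p) = 1"
    using assms(5,6) by (simp_all only: F_def)
  have period: "[F (t * i + r) = F r] (mod int p)" for i r
    unfolding F_def t_def using fib_seq_add_mult_pisano_period[OF \<open>0 < p\<close>] .
  \<comment> \<open>Index \<open>t\<close> behaves like index 0. As indices 1 and 2 have symbol 1,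
    this forces \<open>t\<close> to be at least 3, so the subtractions \<open>t - 1\<close> and
    \<open>t - 2\<close> below are not truncated.\<close>
  have Lt: "Legendre (F t) (int p) = 0"
    using Legendre_cong[OF period[of 1 0]] L0 by simp
  have "t \<noteq> 0"
    using pisano_period_pos[OF \<open>0 < p\<close>] by (simp add: t_def)
  moreover have "t \<noteq> 1" "t \<noteq> 2"
    using Lt L1 L2 by (metis zero_neq_one)+
  ultimately have t3: "3 \<le> t"
    by simp
  have A_class: "A = legendre_class 1 p 0 b"
    by (auto simp: A_def legendre_class_def F_def t_def)
  have finA: "finite A" and "A \<subseteq> {..<t}"
    by (auto simp: A_def)
  \<comment> \<open>The indices outside \<open>A\<close> number \<open>t - card A\<close>, and all
    of them count negatively in \<open>k\<close>.\<close>
  have k: "k = 2 * int (card A) - int t"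
    using assms(4) card_legendre_classes[of p 0 b] by (simp add: PL_prime_def A_class t_def)

  \<comment> \<open>The labeling and its bijectivity\<close>
  obtain g where g: "bij_betw g (pverts G) {0..<n}"
    using ex_bij_betw_finite_nat[OF G.pair_finite_verts] assms(8) by (auto simp: graph_order_def)
  define f :: "'a + 'a \<times> nat \<Rightarrow> nat"
    where "f x = (case x of Inl v \<Rightarrow> t * g v | Inr (v, w) \<Rightarrow> t * g v + Suc w)" for x
  \<comment> \<open>Coordinates (centre, offset), with offset 0 for the centre itself. Numbering the
    centres by \<open>g\<close> then turns \<open>f\<close> into quotient and remainder
    form.\<close>
  define h :: "'a + 'a \<times> nat \<Rightarrow> 'a \<times> nat"
    where "h x = (case x of Inl v \<Rightarrow> (v, 0) | Inr (v, w) \<Rightarrow> (v, Suc w))" for x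
  have C_verts: "pverts C = Inl ` pverts G \<union> Inr ` (pverts G \<times> {0..<m})"
    by (simp add: C_def corona_def path_graph_def)
  have h: "bij_betw h (pverts C) (pverts G \<times> {0..<t})"
  proof (rule bij_betwI[where g = "\<lambda>(v, r). case r of 0 \<Rightarrow> Inl v | Suc w \<Rightarrow> Inr (v, w)"])
    show "h \<in> pverts C \<rightarrow> pverts G \<times> {0..<t}"
      using t3 by (auto simp: C_verts h_def m_def)
  qed (auto simp: C_verts h_def m_def split: nat.splits)
  have "bij_betw (map_prod g id) (pverts G \<times> {0..<t}) ({0..<n} \<times> {0..<t})"
    using g by (intro bij_betw_map_prod) simp_all
  from bij_betw_trans[OF bij_betw_trans[OF h this] bij_betw_mult_add]
  have "bij_betw ((\<lambda>(i, r). t * i + r) \<circ> (map_prod g id \<circ> h)) (pverts C) {0..<n * t}" .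
  also have "(\<lambda>(i, r). t * i + r) \<circ> (map_prod g id \<circ> h) = f"
    by (auto simp: fun_eq_iff f_def h_def split: sum.splits)
  finally have f: "bij_betw f (pverts C) {0..<n * t}" .
  \<comment> \<open>The order of the corona is read off from the bijection itself.\<close>
  then have bij: "bij_betw f (pverts C) {0..<graph_order C}"
    using bij_betw_same_card by (fastforce simp: graph_order_def)

  \<comment> \<open>Labels of the three kinds of edges\<close>
  have base: "induced_label 0 b p f (Inl u) (Inl v) = 0" for u v
  proof -
    have "[F (t * g u + 0) + F (t * g v + 0) = F 0 + F 0] (mod int p)"
      by (intro cong_add period)
    then have "induced_label 0 b p f (Inl u) (Inl v) = of_bool (Legendre (F 0) (int p) = 1)"
      by (intro induced_label_eq) (simp add: f_def F0 flip: F_def)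
    then show ?thesis
      by (simp add: L0)
  qed
  have spoke: "induced_label 0 b p f (Inl v) (Inr (v, w)) =
      of_bool (Legendre (F (Suc w)) (int p) = 1)" for v w
  proof -
    have "[F (t * g v + 0) + F (t * g v + Suc w) = F 0 + F (Suc w)] (mod int p)"
      by (intro cong_add period)
    then show ?thesis
      by (intro induced_label_eq) (simp add: f_def F0 flip: F_def)
  qed
  \<comment> \<open>Path vertex \<open>w\<close> has offset \<open>w + 1\<close>, so the edge from
    \<open>w\<close> to \<open>w + 1\<close> sums the terms \<open>w + 1\<close> and
    \<open>w + 2\<close>, giving term \<open>w + 3\<close>.\<close>
  have path: "induced_label 0 b p f (Inr (v, w)) (Inr (v, Suc w)) =
      of_bool (Legendre (F (w + 3)) (int p) = 1)" for v w
  proof -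
    have "[F (t * g v + Suc w) + F (t * g v + Suc (Suc w)) = F (Suc w) + F (Suc (Suc w))] (mod int p)"
      by (intro cong_add period)
    moreover have "F (w + 3) = F (Suc w) + F (Suc (Suc w))"
      by (simp add: F_Suc2 eval_nat_numeral)
    ultimately show ?thesis
      by (intro induced_label_eq) (simp add: f_def flip: F_def)
  qed

  \<comment> \<open>Counting labels over one period\<close>
  let ?P = "\<lambda>w. Legendre (F (Suc w)) (int p) = 1"
  let ?Q = "\<lambda>w. Legendre (F (w + 3)) (int p) = 1"
  let ?cP = "card {w. w < m \<and> ?P w}" and ?cQ = "card {w. Suc w < m \<and> ?Q w}"
  let ?dP = "card {w. w < m \<and> \<not> ?P w}" and ?dQ = "card {w. Suc w < m \<and> \<not> ?Q w}"
  \<comment> \<open>Spokes use the indices from 1 to \<open>t - 1\<close>, and the missing index 0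
    is not in \<open>A\<close>.\<close>
  have cP: "?cP = card A"
  proof -
    have "A = Suc ` {w. w < m \<and> ?P w}"
    proof (intro equalityI subsetI)
      fix i assume "i \<in> A"
      with L0 obtain w where "i = Suc w"
        by (cases i) (auto simp: A_def)
      with \<open>i \<in> A\<close> show "i \<in> Suc ` {w. w < m \<and> ?P w}"
        by (auto simp: A_def m_def)
    qed (auto simp: A_def m_def)
    then show ?thesis
      by (simp add: card_image)
  qed
  \<comment> \<open>Path edges use the indices from 3 to \<open>t\<close>. Of the members of
    \<open>A\<close> only 1 and 2 are missed, and the extra index \<open>t\<close> has symbol
    0.\<close>
  have cQ: "?cQ + 2 = card A"
  proof -
    define J where "J = (\<lambda>w. w + 3) ` {w. Suc w < m \<and> ?Q w}"
    have "A = insert 1 (insert 2 J)"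
    proof (intro equalityI subsetI)
      fix i assume "i \<in> A"
      show "i \<in> insert 1 (insert 2 J)"
      proof (cases "i < 3")
        case True
        then have "i \<in> {0, 1, 2}" by auto
        with \<open>i \<in> A\<close> L0 show ?thesis by (auto simp: A_def)
      next
        case False
        then obtain w where "i = w + 3"
          by (metis add.commute le_Suc_ex not_less)
        with \<open>i \<in> A\<close> show ?thesis by (auto simp: A_def m_def J_def)
      qed
    next
      fix i assume "i \<in> insert 1 (insert 2 J)"
      then consider "i = 1" | "i = 2" | w where "i = w + 3" "Suc w < m" "?Q w"
        by (auto simp: J_def)
      then show "i \<in> A"
      proof cases
        case (3 w)
        \<comment> \<open>The range of \<open>w\<close> only gives \<open>w + 3 \<le> t\<close>; the
          boundary case is excluded by the symbol at \<open>t\<close>.\<close>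
        then have "w + 3 \<noteq> t"
          using Lt by auto
        with 3 show ?thesis
          by (auto simp: A_def m_def J_def)
      qed (use L1 L2 t3 in \<open>auto simp: A_def\<close>)
    qed
    moreover have "finite {w. Suc w < m \<and> ?Q w}"
      by (rule finite_subset[of _ "{..<m}"]) auto
    then have "finite J"
      by (simp add: J_def)
    moreover have "1 \<notin> J" "2 \<notin> J"
      by (auto simp: J_def)
    moreover have "card J = ?cQ"
      unfolding J_def by (intro card_image) simp
    ultimately show ?thesis
      by simp
  qed
  have dP: "?cP + ?dP = t - 1"
  proof -
    have "{w. w < m \<and> ?P w} \<union> {w. w < m \<and> \<not> ?P w} = {..<m}" by auto
    then have "card {..<m} = ?cP + ?dP"
      by (subst card_Un_disjoint[symmetric]) auto
    then show ?thesis by (simp add: m_def)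
  qed
  have dQ: "?cQ + ?dQ = t - 2"
  proof -
    have less: "Suc w < m \<longleftrightarrow> w < t - 2" for w
      by (auto simp: m_def)
    have "{w. Suc w < m \<and> ?Q w} \<union> {w. Suc w < m \<and> \<not> ?Q w} = {..<t - 2}"
      by (auto simp: less)
    then have "card {..<t - 2} = ?cQ + ?dQ"
      by (subst card_Un_disjoint[symmetric]) (auto simp: less)
    then show ?thesis by simp
  qed

  \<comment> \<open>Balance of the two labels\<close>
  have e1: "card (edges_labeled 0 b p C f 1) = n * (?cP + ?cQ)"
    unfolding C_def using assms(8)
    by (subst card_edges_labeled_corona_path[where P = ?P and Q = ?Q])
      (simp_all add: G.pair_graph base spoke path graph_order_def)
  have e0: "card (edges_labeled 0 b p C f 0) = graph_size G + n * (?dP + ?dQ)"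
    unfolding C_def using assms(8)
    by (subst card_edges_labeled_corona_path[where P = "\<lambda>w. \<not> ?P w" and Q = "\<lambda>w. \<not> ?Q w"])
      (simp_all add: G.pair_graph base spoke path graph_order_def graph_size_def graph_edges_def)
  \<comment> \<open>Each centre accounts for \<open>2 * t - 3\<close> spokes and path edges, of
    which \<open>2 * card A - 2\<close> have label 1. The excess is thus
    \<open>4 * card A - 2 * t - 1\<close>.\<close>
  have "int (?cP + ?cQ) - int (?dP + ?dQ) = 2 * k - 1"
    using cP cQ dP dQ k t3 by linarith
  then have "int n * int (?cP + ?cQ) - int n * int (?dP + ?dQ) = int n * (2 * k - 1)"
    by (simp only: flip: right_diff_distrib)
  then have "int (card (edges_labeled 0 b p C f 0)) - int (card (edges_labeled 0 b p C f 1)) = \<epsilon>"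
    using assms(10) by (simp only: e0 e1 of_nat_add of_nat_mult)
  with assms(9) bij have "FLC_labeling 0 b p C f"
    by (auto simp: FLC_labeling_def)
  moreover have "simple_connected_graph C"
    unfolding C_def simple_connected_graph_def
    using assms(7) G.pair_graph pair_graph_path_graph pair_graph_corona connected_corona by blast
  ultimately show ?thesis
    unfolding FLC_graph_def C_def m_def t_def by blast
qed

end
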